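(* Let $A=A^\top\in\mathbb{R}^{3\times3}$ be such that $\bar A=\frac12(\mathrm{tr}(A)I-A)$ is positive definite. Consider the attitude kinematics $\dot R=R[\omega]_\times$ on $SO(3)$, with angular velocity $\omega(t)\in\mathbb{R}^3$, coupled with the attitude observer (with error-free measurements) $$\dot{\hat R}=\hat R[\omega]_\times-[\sigma]_\times\hat R,\qquad \sigma=-\psi(AR\hat R^\top),\qquad \hat R(0)\in SO(3),$$ and let $\tilde R=R\hat R^\top$. Let $B\in(0,1)$. Starting from any initial condition $\tilde R(0)\in SO(3)\setminus\Pi$, the time $t_B\ge0$ necessary to enter the ball of radius $B$, i.e. at which $|\tilde R(t_B)|_I=B$, satisfies $$t_B\ge\frac{1}{\lambda_{\max}^{\bar A}}\ln\left(\frac{|\tilde R(0)|_I(1-B^2)^{1/2}}{B(1-|\tilde R(0)|_I^2)^{1/2}}\right).$$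
   Context: $SO(3)=\{R\in\mathbb{R}^{3\times3}: \det R=1,\ RR^\top=I\}$. $[x]_\times$ is the skew-symmetric matrix with $[x]_\times y=x\times y$ for $x,y\in\mathbb{R}^3$; $\mathrm{vex}$ is the inverse of $x\mapsto[x]_\times$ on skew-symmetric matrices. For $M\in\mathbb{R}^{3\times3}$, $\psi(M)=\mathrm{vex}\big((M-M^\top)/2\big)$. For $R\in SO(3)$, $|R|_I\in[0,1]$ is defined by $|R|_I^2=\frac14\mathrm{tr}(I-R)$, and $\Pi=\{R\in SO(3): |R|_I=1\}$. $\lambda_{\max}^{\bar A}$ is the maximum eigenvalue of $\bar A$. *)

theory Defs
  imports "HOL-Analysis.Analysis"
begin

definition SO3 :: "(real^3^3) set" where
  "SO3 = {R. det R = 1 \<and> R ** transpose R = mat 1}"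

lemma SO3_eq_rotation_matrix: "SO3 = {R. rotation_matrix R}"
proof -
  have "orthogonal_matrix R \<longleftrightarrow> R ** transpose R = mat 1" for R :: "real^3^3"
    by (metis orthogonal_matrix_def matrix_left_right_inverse)
  then show ?thesis
    by (auto simp: SO3_def rotation_matrix_def)
qed

definition skew :: "real^3 \<Rightarrow> real^3^3" where
  "skew x = matrix (cross3 x)"

lemma skew_mult: "skew x *v y = cross3 x y"
  by (simp add: skew_def matrix_def cross3_def axis_def matrix_vector_mult_def vec_eq_iff forall_3 sum_3)

(* The inverse of skew; only its values on skew-symmetric matrices, which are exactly
   the range of skew, are meaningful. *)
definition vex :: "real^3^3 \<Rightarrow> real^3" where
  "vex = inv skew"

lemma skew_explicit:
  "skew x = vector [vector [0, - x$3, x$2], vector [x$3, 0, - x$1], vector [- x$2, x$1, 0]]"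
  by (simp add: skew_def matrix_def cross3_def axis_def vec_eq_iff forall_3)

lemma inj_skew: "inj skew"
  by (auto simp: inj_def skew_explicit vec_eq_iff forall_3)

lemma vex_skew: "vex (skew x) = x"
  by (simp add: vex_def inj_skew)

lemma range_skew: "range skew = {M. transpose M = - M}"
proof (intro equalityI subsetI)
  fix M assume "M \<in> range skew"
  then show "M \<in> {M. transpose M = - M}"
    by (auto simp: skew_explicit transpose_def vec_eq_iff forall_3)
next
  fix M :: "real^3^3" assume "M \<in> {M. transpose M = - M}"
  then have skw: "transpose M = - M" by simp
  have M: "M$i$j = - M$j$i" for i j
  proof -
    have "M$i$j = transpose M $ j $ i" by (simp add: transpose_def)
    also have "\<dots> = - M$j$i" by (subst skw) simp
    finally show ?thesis .
  qed
  have "M$1$1 = 0" "M$2$2 = 0" "M$3$3 = 0"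
    using M[of 1 1] M[of 2 2] M[of 3 3] by linarith+
  then have "M = skew (vector [M$3$2, M$1$3, M$2$1])"
    using M[of 1 2] M[of 2 3] M[of 3 1]
    by (simp add: skew_explicit vec_eq_iff forall_3)
  then show "M \<in> range skew" by blast
qed

lemma skew_vex: "transpose M = - M \<Longrightarrow> skew (vex M) = M"
  unfolding vex_def by (rule f_inv_into_f) (simp add: range_skew)

definition psi :: "real^3^3 \<Rightarrow> real^3" where
  "psi M = vex ((1/2) *\<^sub>R (M - transpose M))"

definition attitude_norm :: "real^3^3 \<Rightarrow> real" where
  "attitude_norm R = sqrt (trace (mat 1 - R) / 4)"

lemma attitude_norm_nonneg_SO3:
  assumes "R \<in> SO3"
  shows "0 \<le> attitude_norm R" "(attitude_norm R)\<^sup>2 = trace (mat 1 - R) / 4"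
proof -
  have "(R ** transpose R)$i$i = 1" for i
    using assms by (simp add: SO3_def mat_def)
  then have "(\<Sum>j\<in>UNIV. (R$i$j)\<^sup>2) = 1" for i
    by (simp add: matrix_matrix_mult_def transpose_def power2_eq_square)
  then have "(R$i$i)\<^sup>2 \<le> 1" for i
    using member_le_sum[of i UNIV "\<lambda>j. (R$i$j)\<^sup>2"] by simp
  then have "R$i$i \<le> 1" for i
    by (simp add: abs_square_le_1 abs_le_iff)
  then have "0 \<le> trace (mat 1 - R)"
    by (simp add: trace_def mat_def sum_nonneg)
  then show "0 \<le> attitude_norm R" "(attitude_norm R)\<^sup>2 = trace (mat 1 - R) / 4"
    by (simp_all add: attitude_norm_def)
qed

definition Pi_set :: "(real^3^3) set" where
  "Pi_set = {R \<in> SO3. attitude_norm R = 1}"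

definition positive_definite :: "real^'n^'n \<Rightarrow> bool" where
  "positive_definite M \<longleftrightarrow> transpose M = M \<and> (\<forall>x. x \<noteq> 0 \<longrightarrow> x \<bullet> (M *v x) > 0)"

definition real_eigenvalues :: "real^'n^'n \<Rightarrow> real set" where
  "real_eigenvalues M = {l. \<exists>v. v \<noteq> 0 \<and> M *v v = l *\<^sub>R v}"

(* Used for symmetric matrices only, whose set of real eigenvalues is finite and nonempty. *)
definition lambda_max :: "real^'n^'n \<Rightarrow> real" where
  "lambda_max M = Max (real_eigenvalues M)"

definition A_bar :: "real^3^3 \<Rightarrow> real^3^3" where
  "A_bar A = (1/2) *\<^sub>R (trace A *\<^sub>R mat 1 - A)"

end

theory Submission
  imports Defs
begin

text \<open>
  The error \<open>Q = R Rhat\<^sup>T\<close> obeys the autonomous equation \<open>Q' = Q [- psi (A Q)]\<close>, in which the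
  angular velocity has cancelled. This flow preserves \<open>Q Q\<^sup>T\<close>, hence \<^term>\<open>SO3\<close>, so it can be
  studied through the single scalar \<open>f = |Q|\<^sup>2\<close> and the vector \<open>p = psi Q\<close>. Two algebraic identities
  turn the equation for \<open>Q\<close> into a closed differential inequality for \<open>f\<close>:

  \<^item> \<open>p \<bullet> psi (A Q) = p \<bullet> A_bar p\<close> (\<open>psi_inner_psi_mult\<close>), so that \<open>f' = - (p \<bullet> A_bar p) / 2\<close>;
  \<^item> \<open>|p|\<^sup>2 = 4 f (1 - f)\<close> (\<open>psi_inner_psi_SO3\<close>), so that \<open>f' \<ge> - 2 \<lambda> f (1 - f)\<close>, where \<open>\<lambda>\<close> is the
    largest eigenvalue of \<open>A_bar\<close>.

  In a quaternion \<open>(\<eta>, \<epsilon>)\<close> representing \<open>Q\<close> these are \<open>f = |\<epsilon>|\<^sup>2\<close> and \<open>p = 2 \<eta> \<epsilon>\<close>; the matrix proofs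
  below avoid choosing a lift to the quaternions.

  The right-hand side of the inequality is that of a logistic equation, whose solutions are straight
  lines in the coordinate \<open>ln (f / (1 - f))\<close>. This coordinate therefore drops at rate at most
  \<open>2 \<lambda>\<close>, and the time needed to fall from \<open>f 0\<close> to \<open>B\<^sup>2\<close> is at least the difference of the end values
  divided by \<open>2 \<lambda>\<close>; half of that difference is the logarithm in the bound. Positive definiteness of
  \<open>A_bar\<close> makes \<open>f\<close> nonincreasing, which confines \<open>f\<close> to \<open>[B\<^sup>2, f 0]\<close>, inside \<open>(0, 1)\<close>, up to the
  hitting time. A start at the identity is covered by the convention \<open>ln 0 = 0\<close>.
\<close>

section \<open>Matrix operations as bounded linear maps\<close>

lemma bounded_bilinear_matrix_matrix_mult:
  "bounded_bilinear ((**) :: real^'n^'m \<Rightarrow> real^'p^'n \<Rightarrow> real^'p^'m)"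
  unfolding bilinear_conv_bounded_bilinear [symmetric] bilinear_def
  by (intro conjI allI linearI)
    (simp_all add: matrix_matrix_mult_def vec_eq_iff algebra_simps sum.distrib sum_distrib_left)

lemma bounded_linear_transpose:
  "bounded_linear (transpose :: real^'n^'m \<Rightarrow> real^'m^'n)"
  by (intro linear_conv_bounded_linear [THEN iffD1] linearI)
    (simp_all add: transpose_def vec_eq_iff)

lemma bounded_linear_trace: "bounded_linear (trace :: real^'n^'n \<Rightarrow> real)"
  by (intro linear_conv_bounded_linear [THEN iffD1] linearI)
    (simp_all add: trace_def sum.distrib sum_distrib_left)

section \<open>The largest eigenvalue of a symmetric matrix\<close>

lemma symmetric_inner_swap:
  fixes M :: "real^'n^'n"
  assumes "transpose M = M"
  shows "x \<bullet> (M *v y) = (M *v x) \<bullet> y"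
  by (metis assms dot_lmul_matrix vector_transpose_matrix)

text \<open>
  Eigenvectors of a symmetric matrix for distinct eigenvalues are orthogonal, hence independent.
\<close>

lemma finite_real_eigenvalues:
  fixes M :: "real^'n^'n"
  assumes sym: "transpose M = M"
  shows "finite (real_eigenvalues M)"
proof -
  let ?L = "real_eigenvalues M"
  obtain e where e: "\<And>l. l \<in> ?L \<Longrightarrow> e l \<noteq> 0 \<and> M *v e l = l *\<^sub>R e l"
    using bchoice [of ?L "\<lambda>l v. v \<noteq> 0 \<and> M *v v = l *\<^sub>R v"] by (auto simp: real_eigenvalues_def)
  have orth: "orthogonal (e k) (e l)" if "k \<in> ?L" "l \<in> ?L" "k \<noteq> l" for k l
  proof -
    have "l * (e k \<bullet> e l) = k * (e k \<bullet> e l)"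
      using symmetric_inner_swap [OF sym, of "e k" "e l"] e that by simp
    then show ?thesis
      using that by (simp add: orthogonal_def)
  qed
  have "inj_on e ?L"
    by (metis e inj_onI scaleR_right_imp_eq)
  moreover have "pairwise orthogonal (e ` ?L)"
    using orth by (auto simp: pairwise_def)
  then have "independent (e ` ?L)"
    using e by (intro pairwise_orthogonal_independent) auto
  then have "finite (e ` ?L)"
    by (rule independent_imp_finite)
  ultimately show ?thesis
    by (simp add: finite_image_iff)
qed

text \<open>
  A zero of a nonnegative quadratic form is a minimum, so the gradient \<open>2 M v\<close> vanishes there: moving
  from \<open>v\<close> a short way against \<open>w = M v\<close> changes the form by \<open>- 2 s |w|\<^sup>2 + O(s\<^sup>2)\<close>.
\<close>

lemma nonneg_quadratic_form_kernel:
  fixes M :: "real^'n^'n"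
  assumes sym: "transpose M = M"
    and nonneg: "\<And>x. 0 \<le> x \<bullet> (M *v x)"
    and zero: "v \<bullet> (M *v v) = 0"
  shows "M *v v = 0"
proof (rule ccontr)
  assume "M *v v \<noteq> 0"
  define w where "w = M *v v"
  define c where "c = w \<bullet> (M *v w)"
  have w: "w \<bullet> w > 0"
    using \<open>M *v v \<noteq> 0\<close> by (simp add: w_def)
  have c: "c \<ge> 0"
    by (simp add: c_def nonneg)
  \<comment> \<open>A step with \<open>s c \<le> w \<bullet> w\<close>, so that the first-order term dominates; the summand 1 covers \<open>c = 0\<close>.\<close>
  define s where "s = (w \<bullet> w) / (c + 1)"
  have s: "s > 0"
    using w c by (simp add: s_def)
  have "(v - s *\<^sub>R w) \<bullet> (M *v (v - s *\<^sub>R w)) = s * (s * c - 2 * (w \<bullet> w))"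
    using zero symmetric_inner_swap [OF sym, of v w]
    by (simp add: c_def w_def algebra_simps matrix_vector_mult_diff_distrib inner_diff_left
        inner_diff_right inner_commute)
  also have "s * c \<le> w \<bullet> w"
    using w c by (simp add: s_def field_simps)
  then have "s * (s * c - 2 * (w \<bullet> w)) < 0"
    using s w by (intro mult_pos_neg) linarith+
  finally show False
    using nonneg [of "v - s *\<^sub>R w"] by simp
qed

text \<open>
  The maximum \<open>\<mu>\<close> of the form on the unit sphere is attained, and \<open>\<mu> I - M\<close> is a nonnegative form
  that vanishes at a maximizer. The maximizer is thus an eigenvector for \<open>\<mu>\<close>, whence
  \<open>\<mu> \<le> lambda_max M\<close>. The second conclusion also rests on this: it says that the set whose
  \<^const>\<open>Max\<close> defines \<^const>\<open>lambda_max\<close> is nonempty.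
\<close>

lemma quadratic_form_le_lambda_max:
  fixes M :: "real^'n^'n"
  assumes sym: "transpose M = M"
  shows "x \<bullet> (M *v x) \<le> lambda_max M * (x \<bullet> x)"
    and "lambda_max M \<in> real_eigenvalues M"
proof -
  let ?q = "\<lambda>x. x \<bullet> (M *v x)"
  have "continuous_on (sphere 0 1) ?q"
    by (intro continuous_intros linear_continuous_on linear_conv_bounded_linear [THEN iffD1]) simp
  moreover have "sphere (0 :: real^'n) 1 \<noteq> {}"
    by simp
  ultimately obtain v where v: "norm v = 1" "\<And>y. norm y = 1 \<Longrightarrow> ?q y \<le> ?q v"
    using continuous_attains_sup [OF compact_sphere, of 0 1 ?q] by auto
  define \<mu> where "\<mu> = ?q v"
  have le: "?q y \<le> \<mu> * (y \<bullet> y)" for y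
  proof (cases "y = 0")
    case False
    then have "?q ((1 / norm y) *\<^sub>R y) \<le> \<mu>"
      unfolding \<mu>_def by (intro v) simp
    then show ?thesis
      using False
      by (simp add: matrix_vector_mult_scaleR dot_square_norm power2_eq_square pos_divide_le_eq)
  qed simp
  define N where "N = \<mu> *\<^sub>R mat 1 - M"
  have N: "N *v y = \<mu> *\<^sub>R y - M *v y" for y
    by (simp add: N_def matrix_vector_mult_diff_rdistrib scaleR_matrix_vector_assoc [symmetric])
  have "transpose N = N"
    using sym by (simp add: N_def transpose_def mat_def vec_eq_iff)
  moreover have "0 \<le> y \<bullet> (N *v y)" for y
    using le [of y] by (simp add: N inner_diff_right)
  moreover have "v \<bullet> (N *v v) = 0"
    using v(1) by (simp add: N inner_diff_right \<mu>_def dot_square_norm)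
  ultimately have "N *v v = 0"
    by (rule nonneg_quadratic_form_kernel)
  then have mem: "\<mu> \<in> real_eigenvalues M"
    using v(1) unfolding real_eigenvalues_def N by (intro CollectI exI [of _ v]) auto
  have fin: "finite (real_eigenvalues M)"
    using sym by (rule finite_real_eigenvalues)
  then show "lambda_max M \<in> real_eigenvalues M"
    using mem unfolding lambda_max_def by (intro Max_in) auto
  have "\<mu> \<le> lambda_max M"
    using fin mem by (simp add: lambda_max_def)
  then have "\<mu> * (x \<bullet> x) \<le> lambda_max M * (x \<bullet> x)"
    by (intro mult_right_mono) auto
  then show "x \<bullet> (M *v x) \<le> lambda_max M * (x \<bullet> x)"
    using le [of x] by linarith
qed

lemma lambda_max_pos:
  fixes M :: "real^'n^'n"
  assumes "positive_definite M"
  shows "0 < lambda_max M"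
proof -
  obtain v where v: "v \<noteq> 0" "M *v v = lambda_max M *\<^sub>R v"
    using quadratic_form_le_lambda_max(2) [of M] assms
    by (auto simp: positive_definite_def real_eigenvalues_def)
  then have "0 < lambda_max M * (v \<bullet> v)"
    using assms by (metis positive_definite_def inner_scaleR_right)
  then show ?thesis
    by (rule zero_less_mult_pos2) (simp add: v(1))
qed

section \<open>Algebra of the vector part of a matrix\<close>

lemma transpose_skew: "transpose (skew x) = - skew x"
  using range_skew by blast

lemma skew_psi: "skew (psi M) = (1/2) *\<^sub>R (M - transpose M)"
  unfolding psi_def
  by (rule skew_vex) (simp add: transpose_def vec_eq_iff field_simps)

lemma psi_nth:
  "psi M $ 1 = (M$3$2 - M$2$3) / 2"
  "psi M $ 2 = (M$1$3 - M$3$1) / 2"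
  "psi M $ 3 = (M$2$1 - M$1$2) / 2"
  using skew_psi [of M] by (simp_all add: skew_explicit vec_eq_iff forall_3 transpose_def)

text \<open>
  The trace pairs \<open>[v]\<close> only with the skew part of \<open>M\<close>, which is \<open>[psi M]\<close>.
\<close>

lemma trace_mult_skew: "trace (M ** skew v) = - 2 * (psi M \<bullet> v)"
  by (simp add: trace_def matrix_matrix_mult_def skew_explicit sum_3 inner_vec_def psi_nth
      field_simps)

text \<open>
  This follows from \<open>[v]\<^sup>2 = v v\<^sup>T - |v|\<^sup>2 I\<close>. The right-hand side is \<open>- 2 (v \<bullet> (A_bar M) v)\<close>, which is how
  \<^const>\<open>A_bar\<close> enters.
\<close>

lemma trace_mult_skew_skew:
  "trace (M ** (skew v ** skew v)) = v \<bullet> (M *v v) - trace M * (v \<bullet> v)"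
  by (simp add: trace_def matrix_matrix_mult_def matrix_vector_mult_def skew_explicit sum_3
      inner_vec_def algebra_simps)

lemma trace_mult_sym_skew:
  fixes A K :: "real^'n^'n"
  assumes "transpose A = A" "transpose K = - K"
  shows "trace (A ** K) = 0"
proof -
  have "trace (A ** K) = trace (transpose (A ** K))"
    by (simp add: trace_def transpose_def)
  also have "\<dots> = trace (- (K ** A))"
    using assms by (simp add: matrix_transpose_mul
      bounded_bilinear.minus_left [OF bounded_bilinear_matrix_matrix_mult])
  also have "\<dots> = - trace (A ** K)"
    unfolding trace_mul_sym [of A K] by (simp add: trace_def sum_negf)
  finally show ?thesis by simp
qed

text \<open>
  Split \<open>Q = S + [p]\<close> into its symmetric and skew parts. For orthogonal \<open>Q\<close> the product
  \<open>S [p] = (Q\<^sup>2 - (Q\<^sup>T)\<^sup>2) / 4\<close> is skew and has zero trace against the symmetric \<open>A\<close>. In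
  \<open>psi (A Q) \<bullet> p = - tr (A Q [p]) / 2\<close> only the contribution \<open>A [p]\<^sup>2\<close> is left.
\<close>

lemma psi_inner_psi_mult:
  fixes A Q :: "real^3^3"
  assumes sym: "transpose A = A" and orth: "orthogonal_matrix Q"
  shows "psi Q \<bullet> psi (A ** Q) = psi Q \<bullet> (A_bar A *v psi Q)"
proof -
  interpret mm: bounded_bilinear "(**) :: real^3^3 \<Rightarrow> real^3^3 \<Rightarrow> real^3^3"
    by (rule bounded_bilinear_matrix_matrix_mult)
  interpret tp: bounded_linear "transpose :: real^3^3 \<Rightarrow> real^3^3"
    by (rule bounded_linear_transpose)
  define p where "p = psi Q"
  define S where "S = (1/2) *\<^sub>R (Q + transpose Q)"
  have Q: "Q = S + skew p"
    by (simp add: S_def p_def skew_psi algebra_simps flip: scaleR_left.add)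
  have o: "Q ** transpose Q = mat 1" "transpose Q ** Q = mat 1"
    using orth by (auto simp: orthogonal_matrix_def)
  have "transpose (S ** skew p) = - (S ** skew p)"
    by (simp add: S_def p_def skew_psi mm.add_left mm.add_right mm.diff_left mm.diff_right
        mm.scaleR_left mm.scaleR_right tp.add tp.diff tp.scaleR matrix_transpose_mul o algebra_simps)
  then have "trace (A ** (S ** skew p)) = 0"
    by (rule trace_mult_sym_skew [OF sym])
  then have "trace ((A ** Q) ** skew p) = trace (A ** (skew p ** skew p))"
    by (subst Q) (simp add: matrix_mul_assoc [symmetric] mm.add_left mm.add_right trace_add)
  then have "psi (A ** Q) \<bullet> p = (trace A * (p \<bullet> p) - p \<bullet> (A *v p)) / 2"
    by (simp add: trace_mult_skew trace_mult_skew_skew)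
  also have "\<dots> = p \<bullet> (A_bar A *v p)"
    by (simp add: A_bar_def matrix_vector_mult_diff_rdistrib inner_diff_right
        scaleR_matrix_vector_assoc [symmetric])
  finally show ?thesis
    by (simp add: p_def inner_commute)
qed

text \<open>
  In terms of \<open>\<tau> = tr Q\<close> the claim is \<open>4 |p|\<^sup>2 = (3 - \<tau>) (1 + \<tau>)\<close>. Orthogonality alone determines
  the squared entries, \<open>tr (Q Q\<^sup>T) = 3\<close>; the mixed products are governed by the trace of the identity
  \<open>Q = cof Q\<close>, which holds for a rotation because it preserves cross products.
\<close>

lemma psi_inner_psi_SO3:
  assumes Q: "Q \<in> SO3"
  shows "psi Q \<bullet> psi Q = 4 * (attitude_norm Q)\<^sup>2 * (1 - (attitude_norm Q)\<^sup>2)"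
proof -
  define q where "q i j = Q$i$j" for i j
  have rot: "rotation_matrix Q"
    using Q by (simp add: SO3_eq_rotation_matrix)
  have cof: "cross3 (Q *v axis i 1) (Q *v axis j 1) = Q *v cross3 (axis i 1) (axis j 1)" for i j
    by (rule cross_rotation_matrix [OF rot])
  have diag: "q 1 1 = q 2 2 * q 3 3 - q 3 2 * q 2 3"
    "q 2 2 = q 3 3 * q 1 1 - q 1 3 * q 3 1"
    "q 3 3 = q 1 1 * q 2 2 - q 2 1 * q 1 2"
    using cof [of 1 2] cof [of 2 3] cof [of 3 1]
    by (simp_all add: q_def cross3_def vec_eq_iff forall_3 matrix_vector_mult_def sum_3 axis_def)
  have "trace (Q ** transpose Q) = 3"
    using Q by (simp add: SO3_def trace_I)
  then have frob: "(q 1 1)\<^sup>2 + (q 1 2)\<^sup>2 + (q 1 3)\<^sup>2 + (q 2 1)\<^sup>2 + (q 2 2)\<^sup>2 + (q 2 3)\<^sup>2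
      + (q 3 1)\<^sup>2 + (q 3 2)\<^sup>2 + (q 3 3)\<^sup>2 = 3"
    by (simp add: q_def trace_def matrix_matrix_mult_def transpose_def sum_3 power2_eq_square)
  have norm: "(attitude_norm Q)\<^sup>2 = (3 - (q 1 1 + q 2 2 + q 3 3)) / 4"
    by (simp add: attitude_norm_nonneg_SO3(2) [OF Q] q_def trace_def mat_def sum_3)
  have "4 * (psi Q \<bullet> psi Q) = (q 3 2 - q 2 3)\<^sup>2 + (q 1 3 - q 3 1)\<^sup>2 + (q 2 1 - q 1 2)\<^sup>2"
    by (simp add: inner_vec_def sum_3 psi_nth q_def power2_eq_square)
  \<comment> \<open>An identity in free entries: the correction terms are multiples of the constraints \<open>frob\<close> and \<open>diag\<close>.\<close>
  also have "\<dots> = (3 - (q 1 1 + q 2 2 + q 3 3)) * (1 + (q 1 1 + q 2 2 + q 3 3))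
      + (((q 1 1)\<^sup>2 + (q 1 2)\<^sup>2 + (q 1 3)\<^sup>2 + (q 2 1)\<^sup>2 + (q 2 2)\<^sup>2 + (q 2 3)\<^sup>2
      + (q 3 1)\<^sup>2 + (q 3 2)\<^sup>2 + (q 3 3)\<^sup>2) - 3)
      + 2 * ((q 2 2 * q 3 3 - q 3 2 * q 2 3) - q 1 1)
      + 2 * ((q 3 3 * q 1 1 - q 1 3 * q 3 1) - q 2 2)
      + 2 * ((q 1 1 * q 2 2 - q 2 1 * q 1 2) - q 3 3)"
    by (simp add: power2_eq_square algebra_simps)
  also have "\<dots> = (3 - (q 1 1 + q 2 2 + q 3 3)) * (1 + (q 1 1 + q 2 2 + q 3 3))"
    by (simp only: frob diag [symmetric]) simp
  finally show ?thesis
    unfolding norm by (simp add: field_simps)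
qed

text \<open>
  Otherwise \<open>psi_inner_psi_SO3\<close> would give \<open>psi Q\<close> a negative squared norm.
\<close>

lemma attitude_norm_le_1_SO3:
  assumes "Q \<in> SO3"
  shows "attitude_norm Q \<le> 1"
proof (rule ccontr)
  assume "\<not> attitude_norm Q \<le> 1"
  then have gt: "1 < (attitude_norm Q)\<^sup>2"
    by (simp add: one_less_power)
  then have "4 * (attitude_norm Q)\<^sup>2 * (1 - (attitude_norm Q)\<^sup>2) < 0"
    by (intro mult_pos_neg) linarith+
  moreover have "0 \<le> psi Q \<bullet> psi Q"
    by simp
  ultimately show False
    unfolding psi_inner_psi_SO3 [OF assms] by linarith
qed

section \<open>Dynamics of the attitude error\<close>

text \<open>
  The two terms in the derivative of \<open>Q Q\<^sup>T\<close> cancel because \<open>[s]\<close> is skew, so orthogonality persists.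
  The determinant then takes values in \<open>{-1, 1}\<close>, and by continuity it cannot leave \<open>1\<close>.
\<close>

lemma SO3_invariant:
  fixes Q :: "real \<Rightarrow> real^3^3"
  assumes ode: "\<And>t. t \<ge> 0 \<Longrightarrow> (Q has_vector_derivative Q t ** skew (s t)) (at t within {0..})"
    and init: "Q 0 \<in> SO3" and "t \<ge> 0"
  shows "Q t \<in> SO3"
proof -
  interpret mm: bounded_bilinear "(**) :: real^3^3 \<Rightarrow> real^3^3 \<Rightarrow> real^3^3"
    by (rule bounded_bilinear_matrix_matrix_mult)
  have const: "((\<lambda>t. Q t ** transpose (Q t)) has_vector_derivative 0) (at u within {0..})"
    if "u \<in> {0..}" for u
  proof -
    have "((\<lambda>t. Q t ** transpose (Q t)) has_vector_derivative
        Q u ** transpose (Q u ** skew (s u)) + (Q u ** skew (s u)) ** transpose (Q u))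
        (at u within {0..})"
      using that ode [of u]
      by (intro mm.has_vector_derivative
          bounded_linear.has_vector_derivative [OF bounded_linear_transpose]) auto
    then show ?thesis
      by (simp add: matrix_transpose_mul transpose_skew mm.minus_left mm.minus_right
          matrix_mul_assoc)
  qed
  have "\<exists>C. \<forall>u\<in>{0..}. Q u ** transpose (Q u) = C"
    by (rule has_vector_derivative_zero_constant [OF convex_real_interval(1) const]) auto
  then obtain C where C: "\<And>u. u \<in> {0..} \<Longrightarrow> Q u ** transpose (Q u) = C"
    by blast
  have orth: "Q u ** transpose (Q u) = mat 1" if "u \<ge> 0" for u
    using C [of u] C [of 0] init that by (simp add: SO3_def)
  have det: "(det (Q u))\<^sup>2 = 1" if "u \<ge> 0" for u
    using arg_cong [OF orth [OF that], of det] by (simp add: det_mul power2_eq_square)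
  have "continuous_on {0..} Q"
    unfolding continuous_on_eq_continuous_within
    using ode by (auto intro: has_vector_derivative_continuous)
  then have cont: "continuous_on {0..t} (\<lambda>u. det (Q u))"
    unfolding det_3
    by (intro continuous_intros) (auto elim: continuous_on_subset)
  have "det (Q t) = 1"
  proof (rule ccontr)
    assume "det (Q t) \<noteq> 1"
    then have "det (Q t) \<le> 0"
      using det [OF \<open>t \<ge> 0\<close>] by (auto simp: power2_eq_1_iff)
    moreover have "0 \<le> det (Q 0)"
      using init by (simp add: SO3_def)
    ultimately obtain u where "0 \<le> u" "det (Q u) = 0"
      using IVT2' [OF _ _ \<open>t \<ge> 0\<close> cont, of 0] by auto
    then show False
      using det [of u] by simp
  qed
  then show ?thesis
    using orth \<open>t \<ge> 0\<close> by (simp add: SO3_def)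
qed

text \<open>
  The observer copies the true angular velocity \<open>w\<close>, and transposing it makes \<open>[w]\<close> change sign, so
  the two contributions of \<open>w\<close> cancel.
\<close>

lemma attitude_error_kinematics:
  fixes R Rhat :: "real \<Rightarrow> real^3^3"
  assumes R: "(R has_vector_derivative R t ** skew w) (at t within S)"
    and Rhat: "(Rhat has_vector_derivative Rhat t ** skew w - skew s ** Rhat t) (at t within S)"
  shows "((\<lambda>t. R t ** transpose (Rhat t)) has_vector_derivative
    (R t ** transpose (Rhat t)) ** skew s) (at t within S)"
proof -
  interpret mm: bounded_bilinear "(**) :: real^3^3 \<Rightarrow> real^3^3 \<Rightarrow> real^3^3"
    by (rule bounded_bilinear_matrix_matrix_mult)
  interpret tp: bounded_linear "transpose :: real^3^3 \<Rightarrow> real^3^3"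
    by (rule bounded_linear_transpose)
  have "((\<lambda>t. R t ** transpose (Rhat t)) has_vector_derivative
      R t ** transpose (Rhat t ** skew w - skew s ** Rhat t)
      + (R t ** skew w) ** transpose (Rhat t)) (at t within S)"
    by (intro mm.has_vector_derivative tp.has_vector_derivative R Rhat)
  then show ?thesis
    by (simp add: tp.diff matrix_transpose_mul transpose_skew mm.minus_left mm.minus_right
        mm.diff_right matrix_mul_assoc)
qed

text \<open>
  On \<^term>\<open>SO3\<close> the differentiated function is the square of the attitude norm. Using the trace itself
  avoids the square root, which is not differentiable at the identity.
\<close>

lemma attitude_error_rate:
  fixes A :: "real^3^3" and Q :: "real \<Rightarrow> real^3^3"
  assumes sym: "transpose A = A" and orth: "orthogonal_matrix (Q t)"
    and ode: "(Q has_vector_derivative Q t ** skew (- psi (A ** Q t))) (at t within S)"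
  shows "((\<lambda>t. trace (mat 1 - Q t) / 4) has_real_derivative
    - (psi (Q t) \<bullet> (A_bar A *v psi (Q t))) / 2) (at t within S)"
proof -
  have "((\<lambda>t. trace (Q t)) has_real_derivative trace (Q t ** skew (- psi (A ** Q t))))
      (at t within S)"
    using bounded_linear.has_vector_derivative [OF bounded_linear_trace ode]
    by (simp add: has_real_derivative_iff_has_vector_derivative)
  also have "trace (Q t ** skew (- psi (A ** Q t))) = 2 * (psi (Q t) \<bullet> (A_bar A *v psi (Q t)))"
    by (simp add: trace_mult_skew psi_inner_psi_mult [OF sym orth])
  finally show ?thesis
    unfolding trace_sub by (auto intro!: derivative_eq_intros)
qed

section \<open>The hitting-time bound\<close>

text \<open>
  The logistic equation \<open>u' = - c u (1 - u)\<close> is separable and its solutions satisfy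
  \<open>ln (u / (1 - u)) = const - c t\<close>. The differential inequality bounds
  the slope of \<open>f\<close> in this coordinate below by \<open>- c\<close>.
\<close>

lemma logistic_differential_inequality:
  fixes f :: "real \<Rightarrow> real"
  assumes "0 \<le> T"
    and deriv: "\<And>t. 0 \<le> t \<Longrightarrow> t \<le> T \<Longrightarrow> (f has_real_derivative f' t) (at t within {0..T})"
    and range: "\<And>t. 0 \<le> t \<Longrightarrow> t \<le> T \<Longrightarrow> 0 < f t \<and> f t < 1"
    and slope: "\<And>t. 0 \<le> t \<Longrightarrow> t \<le> T \<Longrightarrow> - c * (f t * (1 - f t)) \<le> f' t"
  shows "ln (f 0 / (1 - f 0)) - ln (f T / (1 - f T)) \<le> c * T"
proof -
  define g where "g t = ln (f t) - ln (1 - f t) + c * t" for t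
  have g: "(g has_real_derivative (f' t / (f t * (1 - f t)) + c)) (at t within {0..T})"
    if "t \<in> {0..T}" for t
  proof -
    have r: "0 < f t" "f t < 1"
      using range that by auto
    have d: "(f has_real_derivative f' t) (at t within {0..T})"
      using deriv that by auto
    have "(g has_real_derivative (f' t / f t - (- f' t) / (1 - f t) + c)) (at t within {0..T})"
      unfolding g_def using r
      by (auto intro!: derivative_eq_intros d)
    also have "f' t / f t - (- f' t) / (1 - f t) + c = f' t / (f t * (1 - f t)) + c"
      using r by (simp add: field_simps)
    finally show ?thesis .
  qed
  have "g 0 \<le> g T"
  proof (rule DERIV_nonneg_imp_increasing_open [OF \<open>0 \<le> T\<close>])
    show "continuous_on {0..T} g"
      using g by (rule DERIV_continuous_on)
    fix t assume t: "0 < t" "t < T"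
    then have "(g has_real_derivative (f' t / (f t * (1 - f t)) + c)) (at t)"
      using g [of t] at_within_Icc_at [of 0 t T] by simp
    moreover have "0 \<le> f' t / (f t * (1 - f t)) + c"
    proof -
      have "0 < f t * (1 - f t)"
        using range [of t] t by simp
      then have "- c \<le> f' t / (f t * (1 - f t))"
        using slope [of t] t by (simp add: pos_le_divide_eq)
      then show ?thesis
        by simp
    qed
    ultimately show "\<exists>y. (g has_real_derivative y) (at t) \<and> 0 \<le> y"
      by blast
  qed
  then show ?thesis
    using range [of 0] range [of T] \<open>0 \<le> T\<close> by (simp add: g_def ln_div)
qed

theorem corollary3:
  fixes A :: "real^3^3"
    and R Rhat Rtilde :: "real \<Rightarrow> real^3^3"
    and \<omega> \<sigma> :: "real \<Rightarrow> real^3"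
    and B tB :: real
  assumes A_sym: "A = transpose A"
    and A_bar_pos: "positive_definite (A_bar A)"
    and R_SO3: "\<And>t. t \<ge> 0 \<Longrightarrow> R t \<in> SO3"
    and kinematics: "\<And>t. t \<ge> 0 \<Longrightarrow>
      (R has_vector_derivative R t ** skew (\<omega> t)) (at t within {0..})"
    and observer: "\<And>t. t \<ge> 0 \<Longrightarrow>
      (Rhat has_vector_derivative Rhat t ** skew (\<omega> t) - skew (\<sigma> t) ** Rhat t) (at t within {0..})"
    and correction: "\<And>t. t \<ge> 0 \<Longrightarrow> \<sigma> t = - psi (A ** R t ** transpose (Rhat t))"
    and Rhat_init: "Rhat 0 \<in> SO3"
    and error: "\<And>t. t \<ge> 0 \<Longrightarrow> Rtilde t = R t ** transpose (Rhat t)"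
    and B: "0 < B" "B < 1"
    and Rtilde_init: "Rtilde 0 \<in> SO3 - Pi_set"
    and tB: "tB \<ge> 0" "attitude_norm (Rtilde tB) = B"
  shows "tB \<ge> 1 / lambda_max (A_bar A) *
    ln (attitude_norm (Rtilde 0) * sqrt (1 - B\<^sup>2) / (B * sqrt (1 - (attitude_norm (Rtilde 0))\<^sup>2)))"
proof -
  let ?L = "lambda_max (A_bar A)"
  let ?q = "\<lambda>t. psi (Rtilde t) \<bullet> (A_bar A *v psi (Rtilde t))"
  define f where "f t = trace (mat 1 - Rtilde t) / 4" for t
  have sym: "transpose A = A"
    using A_sym by simp
  have ode: "(Rtilde has_vector_derivative Rtilde t ** skew (- psi (A ** Rtilde t)))
      (at t within {0..})" if "t \<ge> 0" for t
  proof -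
    have "((\<lambda>t. R t ** transpose (Rhat t)) has_vector_derivative Rtilde t ** skew (\<sigma> t))
        (at t within {0..})"
      unfolding error [OF that]
      by (rule attitude_error_kinematics [OF kinematics [OF that] observer [OF that]])
    then have "(Rtilde has_vector_derivative Rtilde t ** skew (\<sigma> t)) (at t within {0..})"
      by (rule has_vector_derivative_transform [rotated 2]) (use that error in auto)
    then show ?thesis
      by (simp add: correction error that matrix_mul_assoc)
  qed
  have SO3: "Rtilde t \<in> SO3" if "t \<ge> 0" for t
    using SO3_invariant [OF ode] Rtilde_init that by blast
  have f: "f t = (attitude_norm (Rtilde t))\<^sup>2" if "t \<ge> 0" for t
    using attitude_norm_nonneg_SO3(2) [OF SO3 [OF that]] by (simp add: f_def)
  have deriv: "(f has_real_derivative - ?q t / 2) (at t within {0..})" if "t \<ge> 0" for t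
  proof -
    have "orthogonal_matrix (Rtilde t)"
      using SO3 [OF that] by (simp add: SO3_eq_rotation_matrix rotation_matrix_def)
    then show ?thesis
      unfolding f_def by (rule attitude_error_rate [OF sym _ ode [OF that]])
  qed
  have q_nonneg: "0 \<le> ?q t" for t
    using A_bar_pos unfolding positive_definite_def
    by (cases "psi (Rtilde t) = 0") (auto intro: less_imp_le)
  have q_le: "?q t \<le> ?L * (4 * f t * (1 - f t))" if "t \<ge> 0" for t
  proof -
    have "?q t \<le> ?L * (psi (Rtilde t) \<bullet> psi (Rtilde t))"
      using A_bar_pos
      by (intro quadratic_form_le_lambda_max(1)) (simp add: positive_definite_def)
    then show ?thesis
      by (simp add: psi_inner_psi_SO3 [OF SO3 [OF that]] f [OF that])
  qed
  have mono: "f v \<le> f u" if "0 \<le> u" "u \<le> v" for u v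
  proof (rule DERIV_nonpos_imp_decreasing_open [OF \<open>u \<le> v\<close>])
    show "continuous_on {u..v} f"
    proof (rule continuous_on_subset)
      show "continuous_on {0..} f"
        using deriv by (intro DERIV_continuous_on) auto
    qed (use that in auto)
    show "\<exists>y. (f has_real_derivative y) (at t) \<and> y \<le> 0" if "u < t" "t < v" for t
    proof -
      have "at t within {0..} = at t"
        using that \<open>0 \<le> u\<close> by (intro at_within_interior) simp
      then have "(f has_real_derivative - ?q t / 2) (at t)"
        using deriv [of t] that \<open>0 \<le> u\<close> by simp
      then show ?thesis
        using q_nonneg [of t] by (intro exI [of _ "- ?q t / 2"]) simp
    qed
  qed
  define a where "a = attitude_norm (Rtilde 0)"
  have a: "0 \<le> a" "f 0 = a\<^sup>2"
    using attitude_norm_nonneg_SO3(1) [OF SO3 [of 0]] f [of 0] by (auto simp: a_def)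
  have fT: "f tB = B\<^sup>2"
    using f tB by simp
  \<comment> \<open>Off \<open>Pi_set\<close> the start lies strictly below the level 1, where \<open>ln (f / (1 - f))\<close> is singular.\<close>
  have "a \<noteq> 1"
    using Rtilde_init by (simp add: Pi_set_def a_def)
  moreover have "a \<le> 1"
    using attitude_norm_le_1_SO3 [OF SO3 [of 0]] by (simp add: a_def)
  ultimately have a1: "a < 1"
    by simp
  have L: "0 < ?L"
    using A_bar_pos by (rule lambda_max_pos)
  show ?thesis
  proof (cases "a = 0")
    case True
    then show ?thesis
      using tB(1) by (simp add: a_def)
  next
    case False
    then have a0: "0 < a"
      using a by simp
    have sq1: "a\<^sup>2 < 1" "B\<^sup>2 < 1"
      using a1 a0 B by (simp_all add: power_less_one_iff)
    have "ln (f 0 / (1 - f 0)) - ln (f tB / (1 - f tB)) \<le> 2 * ?L * tB"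
    proof (rule logistic_differential_inequality [OF tB(1)])
      fix t assume t: "0 \<le> t" "t \<le> tB"
      show "(f has_real_derivative - ?q t / 2) (at t within {0..tB})"
        using deriv [OF t(1)] by (rule has_field_derivative_subset) auto
      \<comment> \<open>Monotonicity gives \<open>B\<^sup>2 = f tB \<le> f t \<le> f 0 = a\<^sup>2\<close>.\<close>
      show "0 < f t \<and> f t < 1"
        using mono [OF t] mono [OF order_refl t(1)] fT a(2) sq1 B
          zero_less_power [OF B(1), of 2] by linarith
      show "- (2 * ?L) * (f t * (1 - f t)) \<le> - ?q t / 2"
        using q_le [OF t(1)] by (simp add: algebra_simps)
    qed
    then have "ln (a\<^sup>2 / (1 - a\<^sup>2)) - ln (B\<^sup>2 / (1 - B\<^sup>2)) \<le> 2 * ?L * tB"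
      by (simp add: a fT)
    moreover have "ln (a * sqrt (1 - B\<^sup>2) / (B * sqrt (1 - a\<^sup>2)))
        = (ln (a\<^sup>2 / (1 - a\<^sup>2)) - ln (B\<^sup>2 / (1 - B\<^sup>2))) / 2"
      using a0 sq1 B by (simp add: ln_div ln_mult ln_sqrt ln_realpow field_simps)
    ultimately have "ln (a * sqrt (1 - B\<^sup>2) / (B * sqrt (1 - a\<^sup>2))) \<le> ?L * tB"
      by simp
    then show ?thesis
      using L by (simp add: a_def field_simps)
  qed
qed

end
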